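(* Let $P$ be an Eulerian poset. Then the Eulerian Chow polynomial $\mathrm{H}_P(x)$ of $P$ equals the $h$-polynomial $h(\Delta(P),x)$ of the order complex $\Delta(P)$.
   Context: $P$ is a finite graded bounded poset with rank function $\rho$, rank $r=\rho(\widehat1)$, $\rho_{st}=\rho(t)-\rho(s)$. $P$ is Eulerian if its Möbius function satisfies $\mu_{st}=(-1)^{\rho_{st}}$ for all $s\le t$; then $\varepsilon_{st}(x)=(x-1)^{\rho_{st}}$ defines a kernel in the incidence algebra (maps $[s,t]\mapsto a_{st}(x)\in\mathbb{Z}[x]$, product $(ab)_{st}=\sum_{s\le w\le t}a_{sw}b_{wt}$). Let $\overline{\varepsilon}_{st}=(x-1)^{\rho_{st}-1}$ for $s<t$ and $\overline{\varepsilon}_{ss}=-1$; the Eulerian Chow function is $\mathrm{H}=-(\overline{\varepsilon})^{-1}$ and $\mathrm{H}_P=\mathrm{H}_{\widehat0\widehat1}$. Here $\Delta(P)$ is the simplicial complex whose faces are the chains of the proper part $P\smallsetminus\{\widehat0,\widehat1\}$, so that the number $f_i$ of faces with $i$ elements is $\sum_{S\subseteq\{1,\dots,r-1\},|S|=i}$(number of chains with rank set $S$), with $f_0=1$. With $d=\dim\Delta(P)+1$, $f(\Delta,x)=\sum_{i=0}^d f_ix^{d-i}$ and $h(\Delta,x)=f(\Delta,x-1)$. *)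

theory Defs
  imports "HOL-Computational_Algebra.Polynomial" "HOL-Algebra.Ring"
begin

text \<open>
  A poset is a set \<open>P\<close> in a type of class \<open>order\<close>, with the induced order. This loses no
  generality: sending an element to its principal order ideal embeds any partially ordered set
  into a type \<open>'a set\<close> ordered by inclusion.
\<close>

definition bounded_poset :: "'a::order set \<Rightarrow> bool" where
  "bounded_poset P \<longleftrightarrow> (\<exists>z\<in>P. \<forall>x\<in>P. z \<le> x) \<and> (\<exists>u\<in>P. \<forall>x\<in>P. x \<le> u)"

definition poset_bot :: "'a::order set \<Rightarrow> 'a" where
  "poset_bot P = (LEAST x. x \<in> P)"

definition poset_top :: "'a::order set \<Rightarrow> 'a" where
  "poset_top P = (GREATEST x. x \<in> P)"

definition covered_by :: "'a::order set \<Rightarrow> 'a \<Rightarrow> 'a \<Rightarrow> bool" where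
  "covered_by P s t \<longleftrightarrow> s \<in> P \<and> t \<in> P \<and> s < t \<and> \<not> (\<exists>w\<in>P. s < w \<and> w < t)"

definition rank_function :: "'a::order set \<Rightarrow> ('a \<Rightarrow> nat) \<Rightarrow> bool" where
  "rank_function P \<rho> \<longleftrightarrow>
     \<rho> (poset_bot P) = 0 \<and> (\<forall>s t. covered_by P s t \<longrightarrow> \<rho> t = \<rho> s + 1)"

definition graded_bounded_poset :: "'a::order set \<Rightarrow> ('a \<Rightarrow> nat) \<Rightarrow> bool" where
  "graded_bounded_poset P \<rho> \<longleftrightarrow> finite P \<and> bounded_poset P \<and> rank_function P \<rho>"

text \<open>
  An element \<open>[s,t] \<mapsto> a\<^sub>s\<^sub>t\<close> of the incidence algebra is a binary function that is \<open>0\<close> on the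
  pairs \<open>(s, t)\<close> that do not span an interval of \<open>P\<close>.
\<close>

definition incidence_algebra :: "'a::order set \<Rightarrow> ('a \<Rightarrow> 'a \<Rightarrow> int poly) ring" where
  "incidence_algebra P = \<lparr>
     carrier = {a. \<forall>s t. \<not> (s \<in> P \<and> t \<in> P \<and> s \<le> t) \<longrightarrow> a s t = 0},
     mult = (\<lambda>a b s t. \<Sum>w \<in> {w \<in> P. s \<le> w \<and> w \<le> t}. a s w * b w t),
     one = (\<lambda>s t. if s \<in> P \<and> s = t then 1 else 0),
     zero = (\<lambda>s t. 0),
     add = (\<lambda>a b s t. a s t + b s t)\<rparr>"

definition zeta_fun :: "'a::order set \<Rightarrow> 'a \<Rightarrow> 'a \<Rightarrow> int poly" where
  "zeta_fun P s t = (if s \<in> P \<and> t \<in> P \<and> s \<le> t then 1 else 0)"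

definition moebius_fun :: "'a::order set \<Rightarrow> 'a \<Rightarrow> 'a \<Rightarrow> int poly" where
  "moebius_fun P = inv\<^bsub>incidence_algebra P\<^esub> (zeta_fun P)"

text \<open>
  A rank function is strictly increasing on a finite poset, so the subtractions on \<open>nat\<close>
  in the next two definitions do not truncate.
\<close>

definition eulerian_poset :: "'a::order set \<Rightarrow> ('a \<Rightarrow> nat) \<Rightarrow> bool" where
  "eulerian_poset P \<rho> \<longleftrightarrow> graded_bounded_poset P \<rho> \<and>
     (\<forall>s\<in>P. \<forall>t\<in>P. s \<le> t \<longrightarrow> moebius_fun P s t = (- 1) ^ (\<rho> t - \<rho> s))"

definition eps_bar :: "'a::order set \<Rightarrow> ('a \<Rightarrow> nat) \<Rightarrow> 'a \<Rightarrow> 'a \<Rightarrow> int poly" where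
  "eps_bar P \<rho> s t =
     (if s \<in> P \<and> t \<in> P \<and> s < t then [:- 1, 1:] ^ (\<rho> t - \<rho> s - 1)
      else if s \<in> P \<and> s = t then - 1
      else 0)"

definition eulerian_chow_function ::
    "'a::order set \<Rightarrow> ('a \<Rightarrow> nat) \<Rightarrow> 'a \<Rightarrow> 'a \<Rightarrow> int poly" where
  "eulerian_chow_function P \<rho> =
     \<ominus>\<^bsub>incidence_algebra P\<^esub> (inv\<^bsub>incidence_algebra P\<^esub> (eps_bar P \<rho>))"

definition eulerian_chow_polynomial :: "'a::order set \<Rightarrow> ('a \<Rightarrow> nat) \<Rightarrow> int poly" where
  "eulerian_chow_polynomial P \<rho> = eulerian_chow_function P \<rho> (poset_bot P) (poset_top P)"

definition order_complex :: "'a::order set \<Rightarrow> 'a set set" where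
  "order_complex P =
     {C. C \<subseteq> P - {poset_bot P, poset_top P} \<and> Complete_Partial_Order.chain (\<le>) C}"

text \<open>
  Simplicial complexes are given by their set of faces, the empty face included; the complex
  whose only face is empty has dimension \<open>-1\<close>.
\<close>

definition complex_dim :: "'a set set \<Rightarrow> int" where
  "complex_dim K = int (Max (card ` K)) - 1"

definition face_number :: "'a set set \<Rightarrow> nat \<Rightarrow> nat" where
  "face_number K i = card {F \<in> K. card F = i}"

definition f_polynomial :: "'a set set \<Rightarrow> int poly" where
  "f_polynomial K =
     (let d = nat (complex_dim K + 1) in \<Sum>i = 0..d. monom (int (face_number K i)) (d - i))"

definition h_polynomial :: "'a set set \<Rightarrow> int poly" where
  "h_polynomial K = pcompose (f_polynomial K) [:- 1, 1:]"

text \<open>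
  The incidence algebra is a ring in which \<open>zeta_fun P\<close> and \<open>eps_bar P \<rho>\<close> are units, so the
  inverses above are genuine.
\<close>

lemma incidence_mult_assoc:
  fixes a b c :: "'a::order \<Rightarrow> 'a \<Rightarrow> int poly"
  assumes "finite P"
  shows "(\<Sum>v \<in> {v \<in> P. s \<le> v \<and> v \<le> t}. (\<Sum>w \<in> {w \<in> P. s \<le> w \<and> w \<le> v}. a s w * b w v) * c v t) =
         (\<Sum>w \<in> {w \<in> P. s \<le> w \<and> w \<le> t}. a s w * (\<Sum>v \<in> {v \<in> P. w \<le> v \<and> v \<le> t}. b w v * c v t))"
proof -
  have "(\<Sum>v \<in> {v \<in> P. s \<le> v \<and> v \<le> t}. (\<Sum>w \<in> {w \<in> P. s \<le> w \<and> w \<le> v}. a s w * b w v) * c v t) =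
        (\<Sum>v \<in> {v \<in> P. s \<le> v \<and> v \<le> t}. \<Sum>w | w \<in> P \<and> s \<le> w \<and> w \<le> t \<and> w \<le> v. a s w * b w v * c v t)"
    by (intro sum.cong) (auto simp: sum_distrib_right intro!: sum.cong)
  also have "\<dots> = (\<Sum>v \<in> {v \<in> P. s \<le> v \<and> v \<le> t}. \<Sum>w | w \<in> {w \<in> P. s \<le> w \<and> w \<le> t} \<and> w \<le> v. a s w * b w v * c v t)"
    by (simp add: conj_assoc)
  also have "\<dots> = (\<Sum>w \<in> {w \<in> P. s \<le> w \<and> w \<le> t}. \<Sum>v | v \<in> {v \<in> P. s \<le> v \<and> v \<le> t} \<and> w \<le> v. a s w * b w v * c v t)"
    using assms by (intro sum.swap_restrict) auto
  also have "\<dots> = (\<Sum>w \<in> {w \<in> P. s \<le> w \<and> w \<le> t}. a s w * (\<Sum>v \<in> {v \<in> P. w \<le> v \<and> v \<le> t}. b w v * c v t))"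
    by (intro sum.cong) (auto simp: sum_distrib_left mult.assoc intro!: sum.cong)
  finally show ?thesis .
qed

lemma ring_incidence_algebra:
  assumes P: "finite P"
  shows "ring (incidence_algebra P)"
proof (rule ringI)
  show "abelian_group (incidence_algebra P)"
  proof (rule abelian_groupI)
    fix a assume a: "a \<in> carrier (incidence_algebra P)"
    show "\<exists>b\<in>carrier (incidence_algebra P). b \<oplus>\<^bsub>incidence_algebra P\<^esub> a = \<zero>\<^bsub>incidence_algebra P\<^esub>"
      using a by (intro bexI[of _ "\<lambda>s t. - a s t"]) (auto simp: incidence_algebra_def)
  qed (auto simp: incidence_algebra_def add_ac)
  show "monoid (incidence_algebra P)"
  proof (rule monoidI)
    fix a assume a: "a \<in> carrier (incidence_algebra P)"
    show "\<one>\<^bsub>incidence_algebra P\<^esub> \<otimes>\<^bsub>incidence_algebra P\<^esub> a = a"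
    proof (intro ext)
      fix s t
      have "(\<Sum>w\<in>{w \<in> P. s \<le> w \<and> w \<le> t}. (if s \<in> P \<and> s = w then 1 else 0) * a w t) =
            (\<Sum>w\<in>{w \<in> P. s \<le> w \<and> w \<le> t}. if s = w then a w t else 0)"
        by (intro sum.cong) auto
      then show "(\<one>\<^bsub>incidence_algebra P\<^esub> \<otimes>\<^bsub>incidence_algebra P\<^esub> a) s t = a s t"
        using a P by (auto simp: incidence_algebra_def)
    qed
    show "a \<otimes>\<^bsub>incidence_algebra P\<^esub> \<one>\<^bsub>incidence_algebra P\<^esub> = a"
    proof (intro ext)
      fix s t
      have "(\<Sum>w\<in>{w \<in> P. s \<le> w \<and> w \<le> t}. a s w * (if w \<in> P \<and> w = t then 1 else 0)) =
            (\<Sum>w\<in>{w \<in> P. s \<le> w \<and> w \<le> t}. if t = w then a s w else 0)"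
        by (intro sum.cong) auto
      then show "(a \<otimes>\<^bsub>incidence_algebra P\<^esub> \<one>\<^bsub>incidence_algebra P\<^esub>) s t = a s t"
        using a P by (auto simp: incidence_algebra_def)
    qed
  next
    fix a b
    show "a \<otimes>\<^bsub>incidence_algebra P\<^esub> b \<in> carrier (incidence_algebra P)"
      if "a \<in> carrier (incidence_algebra P)" "b \<in> carrier (incidence_algebra P)"
      using that by (auto simp: incidence_algebra_def intro!: sum.neutral intro: order_trans)
  next
    fix a b c
    show "a \<otimes>\<^bsub>incidence_algebra P\<^esub> b \<otimes>\<^bsub>incidence_algebra P\<^esub> c =
          a \<otimes>\<^bsub>incidence_algebra P\<^esub> (b \<otimes>\<^bsub>incidence_algebra P\<^esub> c)"
      using incidence_mult_assoc[OF P] by (simp add: incidence_algebra_def)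
  qed (auto simp: incidence_algebra_def)
qed (auto simp: incidence_algebra_def algebra_simps sum.distrib)

function incidence_left_inv :: "'a::order set \<Rightarrow> ('a \<Rightarrow> 'a \<Rightarrow> int poly) \<Rightarrow> 'a \<Rightarrow> 'a \<Rightarrow> int poly" where
  "incidence_left_inv P a s t =
     (if finite P \<and> s \<in> P \<and> t \<in> P \<and> s \<le> t then
        if s = t then a s s
        else - (\<Sum>w \<in> {w \<in> P. s \<le> w \<and> w < t}. incidence_left_inv P a s w * a w t) * a t t
      else 0)"
  by pat_completeness auto
termination
proof (relation "measure (\<lambda>(P, a, s, t). card {w \<in> P. s \<le> w \<and> w \<le> t})")
  fix P a and s t w :: "'a::order"
  assume *: "finite P \<and> s \<in> P \<and> t \<in> P \<and> s \<le> t" "w \<in> {w \<in> P. s \<le> w \<and> w < t}"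
  have "{v \<in> P. s \<le> v \<and> v \<le> w} \<subset> {v \<in> P. s \<le> v \<and> v \<le> t}"
    using * by (auto dest: order.strict_trans1)
  then show "((P, a, s, w), (P, a, s, t)) \<in> measure (\<lambda>(P, a, s, t). card {w \<in> P. s \<le> w \<and> w \<le> t})"
    using * by (simp add: psubset_card_mono)
qed simp

declare incidence_left_inv.simps [simp del]

lemma incidence_left_inv_diag: "finite P \<Longrightarrow> t \<in> P \<Longrightarrow> incidence_left_inv P a t t = a t t"
  by (subst incidence_left_inv.simps) simp

lemma incidence_left_inv_carrier: "incidence_left_inv P a \<in> carrier (incidence_algebra P)"
  by (auto simp: incidence_algebra_def incidence_left_inv.simps)

lemma incidence_left_inv_mult:
  assumes P: "finite P" and a: "a \<in> carrier (incidence_algebra P)" "\<forall>s\<in>P. a s s * a s s = 1"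
  shows "incidence_left_inv P a \<otimes>\<^bsub>incidence_algebra P\<^esub> a = \<one>\<^bsub>incidence_algebra P\<^esub>"
proof (intro ext)
  fix s t
  have a0: "a s t = 0" if "\<not> (s \<in> P \<and> t \<in> P \<and> s \<le> t)" for s t
    using a(1) that by (auto simp: incidence_algebra_def)
  have l0: "incidence_left_inv P a s t = 0" if "\<not> (s \<in> P \<and> t \<in> P \<and> s \<le> t)" for s t
    using incidence_left_inv_carrier[of P a] that by (auto simp: incidence_algebra_def)
  consider "s \<in> P" "t \<in> P" "s < t" | "s \<in> P" "s = t" | "\<not> (s \<in> P \<and> t \<in> P \<and> s \<le> t)"
    by (metis order_less_le)
  then have "(\<Sum>w \<in> {w \<in> P. s \<le> w \<and> w \<le> t}. incidence_left_inv P a s w * a w t) =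
             (if s \<in> P \<and> s = t then 1 else 0)"
  proof cases
    case 1
    have "{w \<in> P. s \<le> w \<and> w \<le> t} = insert t {w \<in> P. s \<le> w \<and> w < t}"
      using 1 by auto
    then have "(\<Sum>w \<in> {w \<in> P. s \<le> w \<and> w \<le> t}. incidence_left_inv P a s w * a w t) =
      incidence_left_inv P a s t * a t t + (\<Sum>w \<in> {w \<in> P. s \<le> w \<and> w < t}. incidence_left_inv P a s w * a w t)"
      using P by simp
    also have "incidence_left_inv P a s t * a t t =
      - (\<Sum>w \<in> {w \<in> P. s \<le> w \<and> w < t}. incidence_left_inv P a s w * a w t) * (a t t * a t t)"
      using 1 P by (subst incidence_left_inv.simps) (simp add: mult.assoc)
    finally show ?thesis using 1 a by simp
  next
    case 2
    then have "{w \<in> P. s \<le> w \<and> w \<le> t} = {t}" by auto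
    then show ?thesis using 2 a P by (simp add: incidence_left_inv_diag)
  next
    case 3
    have "incidence_left_inv P a s w * a w t = 0" for w
      using 3 a0[of w t] l0[of s w] order_trans[of s w t] by auto
    then have "(\<Sum>w \<in> {w \<in> P. s \<le> w \<and> w \<le> t}. incidence_left_inv P a s w * a w t) = 0"
      by (rule sum.neutral[rule_format])
    then show ?thesis using 3 by auto
  qed
  then show "(incidence_left_inv P a \<otimes>\<^bsub>incidence_algebra P\<^esub> a) s t = \<one>\<^bsub>incidence_algebra P\<^esub> s t"
    by (simp add: incidence_algebra_def)
qed

lemma incidence_algebra_Units:
  assumes P: "finite P" and a: "a \<in> carrier (incidence_algebra P)" "\<forall>s\<in>P. a s s * a s s = 1"
  shows "a \<in> Units (incidence_algebra P)"
proof -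
  interpret ring "incidence_algebra P"
    by (rule ring_incidence_algebra[OF P])
  define b where "b = incidence_left_inv P a"
  define c where "c = incidence_left_inv P b"
  have carr: "b \<in> carrier (incidence_algebra P)" "c \<in> carrier (incidence_algebra P)"
    by (simp_all add: b_def c_def incidence_left_inv_carrier)
  have ba: "b \<otimes>\<^bsub>incidence_algebra P\<^esub> a = \<one>\<^bsub>incidence_algebra P\<^esub>"
    unfolding b_def using P a by (rule incidence_left_inv_mult)
  have cb: "c \<otimes>\<^bsub>incidence_algebra P\<^esub> b = \<one>\<^bsub>incidence_algebra P\<^esub>"
    unfolding c_def using P carr(1) by (rule incidence_left_inv_mult) (use P a in \<open>simp add: b_def incidence_left_inv_diag\<close>)
  have "c = a"
    using inv_unique[OF cb ba] carr a by simp
  then show ?thesis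
    using ba cb carr a unfolding Units_def by blast
qed

lemma zeta_fun_Units: "finite P \<Longrightarrow> zeta_fun P \<in> Units (incidence_algebra P)"
  by (rule incidence_algebra_Units) (auto simp: zeta_fun_def incidence_algebra_def)

lemma eps_bar_Units: "finite P \<Longrightarrow> eps_bar P \<rho> \<in> Units (incidence_algebra P)"
  by (rule incidence_algebra_Units) (auto simp: eps_bar_def incidence_algebra_def)

end

theory Submission
  imports Defs
begin

text \<open>
  Write \<open>eps_bar = N - 1\<close> with \<open>N\<close> strictly upper triangular, so that
  \<open>H = (1 - N)\<^sup>-\<^sup>1 = 1 + N + N\<^sup>2 + \<dots>\<close>.
  The entry of \<open>N\<^sup>k\<close> at \<open>(s, t)\<close> is a sum over the chains \<open>s = c\<^sub>0 < \<dots> < c\<^sub>k = t\<close>, and each of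
  them contributes \<open>(x - 1)\<close> to the power \<open>\<rho>\<^sub>s\<^sub>t - k\<close>, because the ranks telescope. For
  \<open>(s, t) = (0, 1)\<close> and \<open>r > 0\<close>, deleting \<open>0\<close> and \<open>1\<close> turns these chains into the faces of \<open>\<Delta>(P)\<close>
  with \<open>k - 1\<close> elements, and \<open>r - k = d - (k - 1)\<close>, so the sum is \<open>f(\<Delta>(P), x - 1)\<close>.
\<close>

section \<open>Chains with prescribed endpoints and their generating function\<close>

definition chains_between :: "'a::order set \<Rightarrow> 'a \<Rightarrow> 'a \<Rightarrow> 'a set set" where
  "chains_between P s t =
     {C. C \<subseteq> {w \<in> P. s \<le> w \<and> w \<le> t} \<and> s \<in> C \<and> t \<in> C \<and> Complete_Partial_Order.chain (\<le>) C}"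

text \<open>A chain with \<open>k\<close> steps has \<open>k + 1\<close> elements, so the exponent
  is the rank difference minus \<open>k\<close>, and the sum collects the entries of all powers of
  \<open>N\<close>. For a rank function on a finite poset the subtraction does not truncate, by
  \<open>card_chains_between_le\<close>.\<close>

definition chain_gen_fun :: "'a::order set \<Rightarrow> ('a \<Rightarrow> nat) \<Rightarrow> 'a \<Rightarrow> 'a \<Rightarrow> int poly" where
  "chain_gen_fun P \<rho> s t = (\<Sum>C\<in>chains_between P s t. [:- 1, 1:] ^ (\<rho> t - \<rho> s + 1 - card C))"

lemma finite_chains_between: "finite P \<Longrightarrow> finite (chains_between P s t)"
  by (rule finite_subset[of _ "Pow P"]) (auto simp: chains_between_def)

lemma chains_between_refl: "s \<in> P \<Longrightarrow> chains_between P s s = {{s}}"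
  by (auto simp: chains_between_def chain_def)

lemma chains_between_empty: "\<not> (s \<in> P \<and> t \<in> P \<and> s \<le> t) \<Longrightarrow> chains_between P s t = {}"
  by (auto simp: chains_between_def)

section \<open>Splitting off the top element of a chain\<close>

lemma finite_chain_has_greatest:
  fixes C :: "'a::order set"
  assumes "finite C" "C \<noteq> {}" "Complete_Partial_Order.chain (\<le>) C"
  shows "\<exists>m\<in>C. \<forall>x\<in>C. x \<le> m"
  using finite_has_maximal[OF assms(1,2)] assms(3) by (metis chainD)

lemma chain_insert_upper:
  fixes C :: "'a::order set"
  assumes "Complete_Partial_Order.chain (\<le>) C" "\<forall>x\<in>C. x \<le> t"
  shows "Complete_Partial_Order.chain (\<le>) (insert t C)"
  using assms by (auto simp: chain_def)

lemma insert_chains_between: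
  assumes "C \<in> chains_between P s w" "t \<in> P" "w \<le> t"
  shows "insert t C \<in> chains_between P s t"
proof -
  have "\<forall>x\<in>C. x \<le> t"
    using assms by (auto simp: chains_between_def intro: order_trans)
  then show ?thesis
    using assms by (auto simp: chains_between_def intro!: chain_insert_upper intro: order_trans)
qed

text \<open>Since \<open>s < t\<close>, removing \<open>t\<close> leaves \<open>s\<close> in place,
  so \<open>C - {t}\<close> is nonempty and its greatest element serves as \<open>w\<close>.\<close>

lemma chains_between_remove_top:
  assumes "finite P" "s < t" "C \<in> chains_between P s t"
  shows "\<exists>w\<in>P. s \<le> w \<and> w < t \<and> C - {t} \<in> chains_between P s w"
proof -
  have fin: "finite C" using assms(1,3) by (auto simp: chains_between_def intro: finite_subset)
  have ch: "Complete_Partial_Order.chain (\<le>) (C - {t})"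
    using assms(3) by (auto simp: chains_between_def chain_def)
  have s: "s \<in> C - {t}" using assms by (auto simp: chains_between_def)
  obtain w where w: "w \<in> C - {t}" "\<forall>x\<in>C - {t}. x \<le> w"
    using finite_chain_has_greatest[OF _ _ ch] fin s by blast
  have "w < t" "w \<in> P" "s \<le> w"
    using w assms(3) by (auto simp: chains_between_def)
  then show ?thesis
    using w s ch assms(3) by (auto simp: chains_between_def)
qed

text \<open>The inverse map deletes \<open>t\<close> and records the greatest remaining element as
  \<open>w\<close>. This is the combinatorial form of multiplying a power of \<open>N\<close> by one
  more factor \<open>N\<close> on the right.\<close>

lemma bij_betw_chains_between:
  assumes "finite P" "s < t" "t \<in> P"
  shows "bij_betw (\<lambda>(w, C). insert t C)
    (SIGMA w:{w \<in> P. s \<le> w \<and> w < t}. chains_between P s w) (chains_between P s t)"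
proof (rule bij_betw_imageI)
  show "inj_on (\<lambda>(w, C). insert t C) (SIGMA w:{w \<in> P. s \<le> w \<and> w < t}. chains_between P s w)"
  proof (rule inj_onI, clarsimp)
    fix w C w' C'
    assume *: "w < t" "w' < t" "C \<in> chains_between P s w" "C' \<in> chains_between P s w'"
      "insert t C = insert t C'"
    have "t \<notin> C" "t \<notin> C'" using * by (auto simp: chains_between_def)
    then have "C = C'" using *(5) by (simp add: insert_ident)
    \<comment> \<open>Both \<open>w\<close> and \<open>w'\<close> are the greatest element of the
      same set.\<close>
    then show "w = w' \<and> C = C'" using * by (auto simp: chains_between_def intro: antisym)
  qed
  show "(\<lambda>(w, C). insert t C) ` (SIGMA w:{w \<in> P. s \<le> w \<and> w < t}. chains_between P s w) =
    chains_between P s t"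
  proof (intro equalityI subsetI)
    fix C assume C: "C \<in> chains_between P s t"
    then obtain w where "w \<in> P" "s \<le> w" "w < t" "C - {t} \<in> chains_between P s w"
      using chains_between_remove_top[OF assms(1,2)] by blast
    moreover have "C = insert t (C - {t})" using C by (auto simp: chains_between_def)
    ultimately show
      "C \<in> (\<lambda>(w, C). insert t C) ` (SIGMA w:{w \<in> P. s \<le> w \<and> w < t}. chains_between P s w)"
      by (intro image_eqI[of _ _ "(w, C - {t})"]) auto
  qed (use assms insert_chains_between in fastforce)
qed

section \<open>Rank functions and the length of chains\<close>

lemma ex_lower_cover:
  assumes "finite P" "s \<in> P" "t \<in> P" "s < t"
  shows "\<exists>w. s \<le> w \<and> covered_by P w t"
proof -
  let ?A = "{w \<in> P. s \<le> w \<and> w < t}"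
  have "finite ?A" "?A \<noteq> {}" using assms by auto
  then obtain w where w: "w \<in> ?A" "\<forall>v\<in>?A. w \<le> v \<longrightarrow> w = v"
    using finite_has_maximal[of ?A] by blast
  have "\<not> (w < v \<and> v < t)" if "v \<in> P" for v
  proof
    assume v: "w < v \<and> v < t"
    then have "v \<in> ?A" using w(1) that by (auto intro: order.trans[of s w v])
    then show False using w(2) v by (metis less_imp_le less_irrefl)
  qed
  then have "covered_by P w t"
    using assms(3) w(1) by (auto simp: covered_by_def)
  then show ?thesis using w by blast
qed

text \<open>Descend from \<open>t\<close> through lower covers that stay above \<open>s\<close>:
  every step lowers the rank by exactly one and adds one element to the chain. The number of
  elements strictly below \<open>t\<close> decreases, which drives the induction.\<close>

lemma ex_saturated_chain:
  assumes "finite P" "rank_function P \<rho>" "s \<in> P" "t \<in> P" "s \<le> t"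
  shows "\<exists>C\<in>chains_between P s t. card C + \<rho> s = \<rho> t + 1"
  using assms(4,5)
proof (induction "card {v \<in> P. v < t}" arbitrary: t rule: less_induct)
  case less
  show ?case
  proof (cases "s = t")
    case True
    then show ?thesis using assms(3) by (simp add: chains_between_refl)
  next
    case False
    then obtain w where w: "s \<le> w" "covered_by P w t"
      using ex_lower_cover[of P s t] assms(1,3) less.prems by (auto simp: order_less_le)
    then have wt: "w < t" "w \<in> P" and \<rho>: "\<rho> t = \<rho> w + 1"
      using assms(2) by (auto simp: covered_by_def rank_function_def)
    have "{v \<in> P. v < w} \<subset> {v \<in> P. v < t}" using wt by auto
    then have "card {v \<in> P. v < w} < card {v \<in> P. v < t}"
      using assms(1) by (simp add: psubset_card_mono)
    then obtain C where C: "C \<in> chains_between P s w" "card C + \<rho> s = \<rho> w + 1"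
      using less.hyps[of w] wt w(1) by blast
    have "t \<notin> C" "finite C"
      using C(1) wt assms(1) by (auto simp: chains_between_def intro: finite_subset)
    moreover have "insert t C \<in> chains_between P s t"
      using insert_chains_between[OF C(1)] less.prems wt by simp
    ultimately show ?thesis
      using C(2) \<rho> by (intro bexI[of _ "insert t C"]) auto
  qed
qed

text \<open>A rank function is prescribed only on covers. A saturated chain transfers this to all
  pairs: it contains the two distinct elements \<open>s\<close> and \<open>t\<close>, and its size
  determines the rank difference.\<close>

lemma rank_function_strict_mono:
  assumes "finite P" "rank_function P \<rho>" "s \<in> P" "t \<in> P" "s < t"
  shows "\<rho> s < \<rho> t"
proof -
  obtain C where C: "C \<in> chains_between P s t" "card C + \<rho> s = \<rho> t + 1"
    using ex_saturated_chain[OF assms(1-4)] assms(5) by (auto dest: less_imp_le)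
  have "card {s, t} \<le> card C"
    using C(1) assms(1) by (intro card_mono) (auto simp: chains_between_def intro: finite_subset)
  then show ?thesis using C(2) assms(5) by auto
qed

lemma rank_function_mono:
  assumes "finite P" "rank_function P \<rho>" "s \<in> P" "t \<in> P" "s \<le> t"
  shows "\<rho> s \<le> \<rho> t"
  using rank_function_strict_mono[OF assms(1-4)] assms(5) by (auto simp: order_le_less)

text \<open>By strict monotonicity \<open>\<rho>\<close> is injective on a chain, and its values
  there lie between \<open>\<rho> s\<close> and \<open>\<rho> t\<close>.\<close>

lemma card_chains_between_le:
  assumes "finite P" "rank_function P \<rho>" "C \<in> chains_between P s t"
  shows "card C \<le> \<rho> t - \<rho> s + 1"
proof -
  have C: "C \<subseteq> P" "s \<in> P" "t \<in> P" "\<forall>x\<in>C. s \<le> x \<and> x \<le> t" "s \<le> t"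
      "Complete_Partial_Order.chain (\<le>) C"
    using assms(3) by (auto simp: chains_between_def)
  have "inj_on \<rho> C"
  proof (rule inj_onI)
    fix x y assume "x \<in> C" "y \<in> C" "\<rho> x = \<rho> y"
    moreover from this have "x \<le> y \<or> y \<le> x" using chainD[OF C(6)] by blast
    ultimately show "x = y"
      using rank_function_strict_mono[OF assms(1,2)] C(1) by (metis less_irrefl order_le_less subsetD)
  qed
  moreover have "\<rho> ` C \<subseteq> {\<rho> s..\<rho> t}"
    using C rank_function_mono[OF assms(1,2)] by (auto intro!: C)
  ultimately have "card C \<le> card {\<rho> s..\<rho> t}" by (metis card_image card_mono finite_atLeastAtMost)
  then show ?thesis using rank_function_mono[OF assms(1,2) C(2,3,5)] by simp
qed

section \<open>The Chow function as the generating function of chains\<close>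

lemma chain_gen_fun_rec:
  assumes "finite P" "rank_function P \<rho>" "s \<in> P" "t \<in> P" "s < t"
  shows "chain_gen_fun P \<rho> s t =
    (\<Sum>w\<in>{w \<in> P. s \<le> w \<and> w < t}. chain_gen_fun P \<rho> s w * [:- 1, 1:] ^ (\<rho> t - \<rho> w - 1))"
proof -
  \<comment> \<open>Sort the chains by their greatest element \<open>w\<close> below
    \<open>t\<close>.\<close>
  have "chain_gen_fun P \<rho> s t =
    (\<Sum>(w, C)\<in>(SIGMA w:{w \<in> P. s \<le> w \<and> w < t}. chains_between P s w).
       [:- 1, 1:] ^ (\<rho> t - \<rho> s + 1 - card (insert t C)))"
    unfolding chain_gen_fun_def
    by (subst sum.reindex_bij_betw[OF bij_betw_chains_between[OF assms(1,5,4)], symmetric])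
      (simp add: case_prod_unfold)
  also have "\<dots> = (\<Sum>w\<in>{w \<in> P. s \<le> w \<and> w < t}. \<Sum>C\<in>chains_between P s w.
       [:- 1, 1:] ^ (\<rho> t - \<rho> s + 1 - card (insert t C)))"
    using assms(1) by (subst sum.Sigma) (auto intro: finite_chains_between)
  also have "\<dots> = (\<Sum>w\<in>{w \<in> P. s \<le> w \<and> w < t}. \<Sum>C\<in>chains_between P s w.
       [:- 1, 1:] ^ (\<rho> w - \<rho> s + 1 - card C) * [:- 1, 1:] ^ (\<rho> t - \<rho> w - 1))"
  proof (intro sum.cong refl, clarify)
    fix w C assume w: "w \<in> P" "s \<le> w" "w < t" and C: "C \<in> chains_between P s w"
    have "t \<notin> C" "finite C"
      using C w assms(1) by (auto simp: chains_between_def intro: finite_subset)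
    \<comment> \<open>These bounds exclude truncation in every subtraction. The element
      \<open>t\<close> accounts for the \<open>- 1\<close> in the second exponent.\<close>
    moreover have "\<rho> w < \<rho> t" "\<rho> s \<le> \<rho> w" "card C \<le> \<rho> w - \<rho> s + 1"
      using rank_function_strict_mono[OF assms(1,2) w(1) assms(4) w(3)]
        rank_function_mono[OF assms(1-3) w(1,2)] card_chains_between_le[OF assms(1,2) C] by auto
    ultimately have "\<rho> t - \<rho> s + 1 - card (insert t C) =
        (\<rho> w - \<rho> s + 1 - card C) + (\<rho> t - \<rho> w - 1)"
      by simp
    then show "[:- 1, 1:] ^ (\<rho> t - \<rho> s + 1 - card (insert t C)) =
        [:- 1, 1 :: int:] ^ (\<rho> w - \<rho> s + 1 - card C) * [:- 1, 1:] ^ (\<rho> t - \<rho> w - 1)"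
      by (simp only: power_add)
  qed
  finally show ?thesis by (simp add: chain_gen_fun_def sum_distrib_right)
qed

lemma chain_gen_fun_refl: "s \<in> P \<Longrightarrow> chain_gen_fun P \<rho> s s = 1"
  by (simp add: chain_gen_fun_def chains_between_refl)

lemma chain_gen_fun_carrier: "chain_gen_fun P \<rho> \<in> carrier (incidence_algebra P)"
  by (simp add: incidence_algebra_def chain_gen_fun_def chains_between_empty)

lemma uminus_incidence_algebra:
  assumes "finite P" "a \<in> carrier (incidence_algebra P)"
  shows "\<ominus>\<^bsub>incidence_algebra P\<^esub> a = (\<lambda>s t. - a s t)"
proof -
  interpret ring "incidence_algebra P"
    by (rule ring_incidence_algebra[OF assms(1)])
  show ?thesis
    by (rule minus_equality) (use assms(2) in \<open>auto simp: incidence_algebra_def\<close>)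
qed

text \<open>Off the diagonal, the recursion makes the terms with \<open>w < t\<close> add up to
  \<open>chain_gen_fun P \<rho> s t\<close>, and the term \<open>w = t\<close> cancels this because
  \<open>eps_bar P \<rho> t t = - 1\<close>.\<close>

lemma chain_gen_fun_mult_eps_bar:
  assumes "finite P" "rank_function P \<rho>"
  shows "chain_gen_fun P \<rho> \<otimes>\<^bsub>incidence_algebra P\<^esub> eps_bar P \<rho> =
    (\<lambda>s t. - \<one>\<^bsub>incidence_algebra P\<^esub> s t)"
proof (intro ext)
  fix s t
  consider "s \<in> P" "t \<in> P" "s < t" | "s \<in> P" "s = t" | "\<not> (s \<in> P \<and> t \<in> P \<and> s \<le> t)"
    by (metis order_less_le)
  then have "(\<Sum>w \<in> {w \<in> P. s \<le> w \<and> w \<le> t}. chain_gen_fun P \<rho> s w * eps_bar P \<rho> w t) =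
             - (if s \<in> P \<and> s = t then 1 else 0)"
  proof cases
    case 1
    have "{w \<in> P. s \<le> w \<and> w \<le> t} = insert t {w \<in> P. s \<le> w \<and> w < t}"
      using 1 by auto
    then have "(\<Sum>w \<in> {w \<in> P. s \<le> w \<and> w \<le> t}. chain_gen_fun P \<rho> s w * eps_bar P \<rho> w t) =
      - chain_gen_fun P \<rho> s t +
        (\<Sum>w \<in> {w \<in> P. s \<le> w \<and> w < t}. chain_gen_fun P \<rho> s w * eps_bar P \<rho> w t)"
      using assms(1) 1 by (simp add: eps_bar_def)
    also have "(\<Sum>w \<in> {w \<in> P. s \<le> w \<and> w < t}. chain_gen_fun P \<rho> s w * eps_bar P \<rho> w t) =
        chain_gen_fun P \<rho> s t"
      unfolding chain_gen_fun_rec[OF assms 1]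
      using 1 by (intro sum.cong) (auto simp: eps_bar_def)
    finally show ?thesis using 1 by simp
  next
    case 2
    then have "{w \<in> P. s \<le> w \<and> w \<le> t} = {t}" by auto
    then show ?thesis using 2 by (simp add: chain_gen_fun_refl eps_bar_def)
  next
    case 3
    then have "\<forall>w\<in>{w \<in> P. s \<le> w \<and> w \<le> t}. chain_gen_fun P \<rho> s w * eps_bar P \<rho> w t = 0"
      by (auto simp: chain_gen_fun_def chains_between_empty eps_bar_def)
    then show ?thesis using 3 by (auto simp: sum.neutral)
  qed
  then show "(chain_gen_fun P \<rho> \<otimes>\<^bsub>incidence_algebra P\<^esub> eps_bar P \<rho>) s t =
      - \<one>\<^bsub>incidence_algebra P\<^esub> s t"
    by (simp add: incidence_algebra_def)
qed

text \<open>As \<open>eps_bar P \<rho>\<close> is a unit, the one-sided product suffices: multiply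
  it on the right by the inverse.\<close>

lemma eulerian_chow_function_eq_chain_gen_fun:
  assumes "finite P" "rank_function P \<rho>"
  shows "eulerian_chow_function P \<rho> = chain_gen_fun P \<rho>"
proof -
  interpret ring "incidence_algebra P"
    by (rule ring_incidence_algebra[OF assms(1)])
  let ?R = "incidence_algebra P" and ?G = "chain_gen_fun P \<rho>" and ?e = "eps_bar P \<rho>"
  have e: "?e \<in> Units ?R" by (rule eps_bar_Units[OF assms(1)])
  have "?G \<otimes>\<^bsub>?R\<^esub> ?e = \<ominus>\<^bsub>?R\<^esub> \<one>\<^bsub>?R\<^esub>"
    by (simp add: chain_gen_fun_mult_eps_bar[OF assms] uminus_incidence_algebra[OF assms(1)])
  then have "(?G \<otimes>\<^bsub>?R\<^esub> ?e) \<otimes>\<^bsub>?R\<^esub> inv\<^bsub>?R\<^esub> ?e = \<ominus>\<^bsub>?R\<^esub> (inv\<^bsub>?R\<^esub> ?e)"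
    using e by (simp add: l_minus)
  then show ?thesis
    using e chain_gen_fun_carrier[of P \<rho>]
    by (simp add: eulerian_chow_function_def m_assoc Units_closed)
qed

section \<open>Faces of the order complex and its dimension\<close>

lemma poset_bot_least:
  assumes "bounded_poset P"
  shows "poset_bot P \<in> P" "x \<in> P \<Longrightarrow> poset_bot P \<le> x"
proof -
  obtain z where z: "z \<in> P" "\<forall>x\<in>P. z \<le> x" using assms by (auto simp: bounded_poset_def)
  then have "poset_bot P = z" unfolding poset_bot_def by (intro Least_equality) auto
  then show "poset_bot P \<in> P" "x \<in> P \<Longrightarrow> poset_bot P \<le> x" using z by auto
qed

lemma poset_top_greatest:
  assumes "bounded_poset P"
  shows "poset_top P \<in> P" "x \<in> P \<Longrightarrow> x \<le> poset_top P"
proof -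
  obtain z where z: "z \<in> P" "\<forall>x\<in>P. x \<le> z" using assms by (auto simp: bounded_poset_def)
  then have "poset_top P = z" unfolding poset_top_def by (intro Greatest_equality) auto
  then show "poset_top P \<in> P" "x \<in> P \<Longrightarrow> x \<le> poset_top P" using z by auto
qed

text \<open>Faces avoid both bounds, so adding the bounds and deleting them are mutually inverse.
  This includes the one-element poset, where the empty face corresponds to the only chain.\<close>

lemma bij_betw_order_complex:
  assumes "bounded_poset P"
  shows "bij_betw (\<lambda>C. {poset_bot P, poset_top P} \<union> C) (order_complex P)
    (chains_between P (poset_bot P) (poset_top P))"
proof (rule bij_betw_byWitness[where f' = "\<lambda>C. C - {poset_bot P, poset_top P}"])
  show "(\<lambda>C. {poset_bot P, poset_top P} \<union> C) ` order_complex P \<subseteq>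
      chains_between P (poset_bot P) (poset_top P)"
  proof clarify
    fix C assume C: "C \<in> order_complex P"
    have "C \<subseteq> P" using C by (auto simp: order_complex_def)
    then have "Complete_Partial_Order.chain (\<le>) ({poset_bot P, poset_top P} \<union> C)"
      using C poset_bot_least[OF assms] poset_top_greatest[OF assms]
      by (auto simp: order_complex_def chain_def subset_iff)
    then show "{poset_bot P, poset_top P} \<union> C \<in> chains_between P (poset_bot P) (poset_top P)"
      using \<open>C \<subseteq> P\<close> poset_bot_least[OF assms] poset_top_greatest[OF assms]
      by (auto simp: chains_between_def)
  qed
qed (auto simp: order_complex_def chains_between_def chain_def)

lemma finite_order_complex: "finite P \<Longrightarrow> finite (order_complex P)"
  by (rule finite_subset[of _ "Pow P"]) (auto simp: order_complex_def)

text \<open>The summand \<open>card {poset_bot P, poset_top P}\<close> is left unevaluated: it is 1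
  if the bounds coincide and 2 otherwise, so both cases are treated at once.\<close>

lemma card_order_complex_face:
  assumes "finite P" "C \<in> order_complex P"
  shows "card ({poset_bot P, poset_top P} \<union> C) = card C + card {poset_bot P, poset_top P}"
proof -
  have "finite C" "{poset_bot P, poset_top P} \<inter> C = {}"
    using assms by (auto simp: order_complex_def intro: finite_subset)
  then show ?thesis by (simp add: card_Un_disjoint del: Un_insert_left Un_insert_right)
qed

text \<open>A saturated chain from bottom to top, stripped of the bounds, is a face of maximal size.
  The value is \<open>r - 2\<close> for rank \<open>r > 0\<close> and \<open>- 1\<close> for
  \<open>r = 0\<close>.\<close>

lemma complex_dim_order_complex:
  assumes "graded_bounded_poset P \<rho>"
  shows "complex_dim (order_complex P) =
    int (\<rho> (poset_top P)) - int (card {poset_bot P, poset_top P})"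
proof -
  let ?b = "poset_bot P" and ?t = "poset_top P"
  have P: "finite P" "bounded_poset P" "rank_function P \<rho>"
    using assms by (auto simp: graded_bounded_poset_def)
  have \<rho>: "\<rho> ?b = 0" using P(3) by (simp add: rank_function_def)
  note b = poset_bot_least[OF P(2)] and t = poset_top_greatest[OF P(2)]
  note bij = bij_betw_order_complex[OF P(2)]
  obtain C where C: "C \<in> chains_between P ?b ?t" "card C = \<rho> ?t + 1"
    using ex_saturated_chain[OF P(1,3) b(1) t(1) b(2)[OF t(1)]] \<rho> by auto
  then obtain F where F: "F \<in> order_complex P" "C = {?b, ?t} \<union> F"
    using bij by (auto simp: bij_betw_def)
  have cF: "card F + card {?b, ?t} = \<rho> ?t + 1"
    using card_order_complex_face[OF P(1) F(1)] C(2) F(2) by simp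
  have "Max (card ` order_complex P) = card F"
  \<comment> \<open>Any face becomes a chain between the bounds once they are added, so the bound on
    chain sizes limits its cardinality.\<close>
  proof (rule Max_eqI)
    fix n assume "n \<in> card ` order_complex P"
    then obtain G where G: "G \<in> order_complex P" "n = card G" by auto
    then have "{?b, ?t} \<union> G \<in> chains_between P ?b ?t" using bij by (auto simp: bij_betw_def)
    from card_chains_between_le[OF P(1,3) this] show "n \<le> card F"
      using cF \<rho> unfolding card_order_complex_face[OF P(1) G(1)] G(2) by simp
  qed (use F finite_order_complex[OF P(1)] in auto)
  then show ?thesis using cF by (simp add: complex_dim_def)
qed

section \<open>The f- and h-polynomials as sums over faces\<close>

lemma f_polynomial_sum_faces:
  assumes "finite K"
  shows "f_polynomial K = (\<Sum>F\<in>K. monom 1 (nat (complex_dim K + 1) - card F))"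
proof -
  let ?d = "nat (complex_dim K + 1)"
  have d: "?d = Max (card ` K)" by (simp add: complex_dim_def)
  have "(\<Sum>F\<in>K. monom 1 (?d - card F)) =
      (\<Sum>i\<in>{0..?d}. \<Sum>F\<in>{F \<in> K. card F = i}. monom (1 :: int) (?d - card F))"
    \<comment> \<open>Group the faces by cardinality; as \<open>?d\<close> is the largest one, every
      face falls into some group.\<close>
    by (rule sum.group[symmetric]) (use assms d in auto)
  also have "\<dots> = (\<Sum>i = 0..?d. monom (int (face_number K i)) (?d - i))"
    by (intro sum.cong) (auto simp: face_number_def of_nat_monom mult_monom)
  finally show ?thesis by (simp add: f_polynomial_def Let_def)
qed

lemma pcompose_monom: "pcompose (monom (c :: 'a::comm_semiring_1) n) q = smult c (q ^ n)"
  by (induction n) (simp_all add: monom_0 monom_Suc pcompose_pCons)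

lemma h_polynomial_sum_faces:
  assumes "finite K"
  shows "h_polynomial K = (\<Sum>F\<in>K. [:- 1, 1:] ^ (nat (complex_dim K + 1) - card F))"
  by (simp add: h_polynomial_def f_polynomial_sum_faces[OF assms] pcompose_sum pcompose_monom)

theorem theorem5p4:
  fixes P :: "'a::order set" and \<rho> :: "'a \<Rightarrow> nat"
  assumes "eulerian_poset P \<rho>"
  shows "eulerian_chow_polynomial P \<rho> = h_polynomial (order_complex P)"
proof -
  let ?b = "poset_bot P" and ?t = "poset_top P" and ?K = "order_complex P"
  have g: "graded_bounded_poset P \<rho>" using assms by (simp add: eulerian_poset_def)
  then have P: "finite P" "bounded_poset P" "rank_function P \<rho>"
    by (auto simp: graded_bounded_poset_def)
  have \<rho>: "\<rho> ?b = 0" using P(3) by (simp add: rank_function_def)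
  have "eulerian_chow_polynomial P \<rho> = chain_gen_fun P \<rho> ?b ?t"
    by (simp add: eulerian_chow_polynomial_def eulerian_chow_function_eq_chain_gen_fun[OF P(1,3)])
  also have "\<dots> = (\<Sum>F\<in>?K. [:- 1, 1:] ^ (\<rho> ?t + 1 - card ({?b, ?t} \<union> F)))"
    unfolding chain_gen_fun_def
    by (subst sum.reindex_bij_betw[OF bij_betw_order_complex[OF P(2)], symmetric]) (simp add: \<rho>)
  also have "\<dots> = (\<Sum>F\<in>?K. [:- 1, 1:] ^ (nat (complex_dim ?K + 1) - card F))"
  proof (intro sum.cong refl arg_cong[where f = "\<lambda>n. [:- 1, 1:] ^ n"])
    fix F assume "F \<in> ?K"
    \<comment> \<open>Both sides subtract \<open>card F\<close> and \<open>card {?b, ?t}\<close>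
      from \<open>\<rho> ?t + 1\<close>, only in a different order.\<close>
    then show "\<rho> ?t + 1 - card ({?b, ?t} \<union> F) = nat (complex_dim ?K + 1) - card F"
      unfolding card_order_complex_face[OF P(1) \<open>F \<in> ?K\<close>] complex_dim_order_complex[OF g] by linarith
  qed
  also have "\<dots> = h_polynomial ?K"
    by (rule h_polynomial_sum_faces[OF finite_order_complex[OF P(1)], symmetric])
  finally show ?thesis .
qed

end
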